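(* Let $S$ be a finite set of schemas, $c_1$ a coupling map for $S$ over a set $D_1$ and $c_2$ a coupling map for $S$ over a set $D_2$ such that $c_2\preceq c_1$, and let $F$ be a formula function for $S$. If there is a $\Sigma$-structure $\mathcal R_1$ with domain $D_1$ such that $\mathcal R_1\models_{c_1}F$, then there exists a $\Sigma$-structure $\mathcal R_2$ with domain $D_2$ such that $\mathcal R_2\models_{c_2}F$.
   Context: Language signature $\Sigma=(\mathrm{Args},\mathrm{Rels},\mathrm{ar})$: $\mathrm{Args},\mathrm{Rels}$ finite non-empty, $\mathrm{ar}:\mathrm{Rels}\to\mathcal P(\mathrm{Args})\setminus\{\emptyset\}$. A $\Sigma$-structure $\mathcal R=(D,\cdot^{\mathcal R})$: $D$ non-empty, $r^{\mathcal R}$ a set of functions $\mathrm{ar}(r)\to D$. FOL formulas: $\varphi::= r\mid\neg\varphi\mid\varphi\wedge\varphi\mid\varphi\vee\varphi\mid\exists x.\varphi\mid\forall x.\varphi\mid(a,x)\varphi$, semantics over partial assignments $\chi:\mathrm{Args}\cup\mathrm{Var}\rightharpoonup D$: $\mathcal R,\chi\models r$ iff $\chi|_{\mathrm{ar}(r)}\in r^{\mathcal R}$; usual Boolean/quantifier clauses; $\mathcal R,\chi\models(a,x)\varphi$ iff $\mathcal R,\chi[a\mapsto\chi(x)]\models\varphi$. A quantification prefix $\wp$ is a finite word over $\{\exists x,\forall x\}$, each variable at most once, with variables $\mathrm{vars}(\wp)$, existential ones $\exists(\wp)$, universal ones $\forall(\wp)$; $\mathrm{Dep}_\wp(y)$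 for $y\in\exists(\wp)$ is the set of universal variables before $y$. A binding prefix $\flat$ is a finite word over pairs $(a,x)$, each argument at most once, viewed as partial function $\mathrm{Args}\rightharpoonup\mathrm{Var}$ with domain $\mathrm{args}(\flat)$ and range $\mathrm{vars}(\flat)$. A derived relation is a Boolean combination of relations all with the same argument set (its argument set). $\mathrm{Asg}_D(P)$: functions $P\to D$. Skolem map for $\wp$ over $D$: $\theta:\mathrm{Asg}_D(\forall(\wp))\to\mathrm{Asg}_D(\mathrm{vars}(\wp))$, identity on universal variables, and the value at each existential $y$ depends only on the restriction of the input to $\mathrm{Dep}_\wp(y)$. $\mathcal R,\chi\models_\theta\psi$ iff $\mathcal R,\chi'\models\psi$ for all $\chi'$ with domain $\mathrm{dom}(\chi)\cup\mathrm{vars}(\wp)$, $\chi\subseteq\chi'$, $\chi'|_{\mathrm{vars}(\wp)}\in\mathrm{rng}(\theta)$. A schema is $\sigma=(\wp(\sigma),\flat(\sigma))$ with $\mathrm{vars}(\wp(\sigma))=\mathrm{vars}(\flat(\sigma))$; $\mathrm{args}(\sigma)=\mathrm{args}(\flat(\sigma))$; $\mathrm{Sch}(A)$ is the set of schemas with argument set $A$. A coupling map $c$ for $S$ over $D$ assigns to each $\sigma\in S$ a Skolem map $c(\sigma)$ for $\wp(\sigma)$ over $D$. A formula function $F$ for $S$ assigns to each $\sigma\in S$ a derived relation with argument set $\mathrm{args}(\sigma)$; $\mathcal R\models_cF$ iff $\mathcal R,\emptyset\models_{c(\sigma)}\flat(\sigma)F(\sigma)$ for all $\sigma\in S$. Entanglement: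 for $A'\subseteq A\subseteq\mathrm{Args}$ and $S'\subseteq S\cap\mathrm{Sch}(A)$, $\mathrm{Ent}_c(S',A')=\{t:A'\to D\mid\forall\sigma\in S'\,\exists\chi\in\mathrm{rng}(c(\sigma))\,.\,t=(\chi\circ\flat(\sigma))|_{A'}\}$. $c_2\preceq c_1$ iff for all such $A',A,S'$, $\mathrm{Ent}_{c_2}(S',A')\ne\emptyset$ implies $\mathrm{Ent}_{c_1}(S',A')\ne\emptyset$. *)

theory Defs
  imports Main
begin

record ('a, 'r) signature =
  Args :: "'a set"
  Rels :: "'r set"
  ar :: "'r \<Rightarrow> 'a set"

definition is_signature :: "('a, 'r) signature \<Rightarrow> bool" where
  "is_signature \<Sigma> \<longleftrightarrow>
     finite (Args \<Sigma>) \<and> Args \<Sigma> \<noteq> {} \<and> finite (Rels \<Sigma>) \<and> Rels \<Sigma> \<noteq> {} \<and>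
     (\<forall>r\<in>Rels \<Sigma>. ar \<Sigma> r \<subseteq> Args \<Sigma> \<and> ar \<Sigma> r \<noteq> {})"

text \<open>The functions from \<open>P\<close> to \<open>D\<close>, represented as partial maps with domain exactly \<open>P\<close>.\<close>

definition Asg :: "'d set \<Rightarrow> 'p set \<Rightarrow> ('p \<rightharpoonup> 'd) set" where
  "Asg D P = {f. dom f = P \<and> ran f \<subseteq> D}"

record ('a, 'r, 'd) struct =
  Dom :: "'d set"
  Interp :: "'r \<Rightarrow> ('a \<rightharpoonup> 'd) set"

definition is_structure :: "('a, 'r) signature \<Rightarrow> ('a, 'r, 'd) struct \<Rightarrow> bool" where
  "is_structure \<Sigma> R \<longleftrightarrow>
     Dom R \<noteq> {} \<and> (\<forall>r\<in>Rels \<Sigma>. Interp R r \<subseteq> Asg (Dom R) (ar \<Sigma> r))"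

datatype ('a, 'r, 'v) fm =
    Rel 'r
  | Neg "('a, 'r, 'v) fm"
  | Conj "('a, 'r, 'v) fm" "('a, 'r, 'v) fm"
  | Disj "('a, 'r, 'v) fm" "('a, 'r, 'v) fm"
  | Exi 'v "('a, 'r, 'v) fm"
  | Uni 'v "('a, 'r, 'v) fm"
  | Bind 'a 'v "('a, 'r, 'v) fm"

text \<open>Assignments are partial maps on the disjoint sum of arguments (\<open>Inl\<close>) and variables
  (\<open>Inr\<close>). A binding of an unassigned variable leaves the argument undefined; an atom with an
  undefined argument is false in every structure, because \<open>Interp R r\<close> only contains maps with
  domain \<open>ar \<Sigma> r\<close>.\<close>

type_synonym ('a, 'v, 'd) asg = "'a + 'v \<rightharpoonup> 'd"

primrec sat :: "('a, 'r) signature \<Rightarrow> ('a, 'r, 'd) struct \<Rightarrow> ('a, 'v, 'd) asg \<Rightarrow>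
    ('a, 'r, 'v) fm \<Rightarrow> bool" where
  "sat \<Sigma> R \<chi> (Rel r) \<longleftrightarrow> (\<chi> \<circ> Inl) |` ar \<Sigma> r \<in> Interp R r"
| "sat \<Sigma> R \<chi> (Neg \<phi>) \<longleftrightarrow> \<not> sat \<Sigma> R \<chi> \<phi>"
| "sat \<Sigma> R \<chi> (Conj \<phi> \<psi>) \<longleftrightarrow> sat \<Sigma> R \<chi> \<phi> \<and> sat \<Sigma> R \<chi> \<psi>"
| "sat \<Sigma> R \<chi> (Disj \<phi> \<psi>) \<longleftrightarrow> sat \<Sigma> R \<chi> \<phi> \<or> sat \<Sigma> R \<chi> \<psi>"
| "sat \<Sigma> R \<chi> (Exi x \<phi>) \<longleftrightarrow> (\<exists>d\<in>Dom R. sat \<Sigma> R (\<chi>(Inr x \<mapsto> d)) \<phi>)"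
| "sat \<Sigma> R \<chi> (Uni x \<phi>) \<longleftrightarrow> (\<forall>d\<in>Dom R. sat \<Sigma> R (\<chi>(Inr x \<mapsto> d)) \<phi>)"
| "sat \<Sigma> R \<chi> (Bind a x \<phi>) \<longleftrightarrow> sat \<Sigma> R (\<chi>(Inl a := \<chi> (Inr x))) \<phi>"

datatype quant = QEx | QAll

type_synonym 'v qprefix = "(quant \<times> 'v) list"

definition is_qprefix :: "'v qprefix \<Rightarrow> bool" where
  "is_qprefix p \<longleftrightarrow> distinct (map snd p)"

definition qvars :: "'v qprefix \<Rightarrow> 'v set" where
  "qvars p = snd ` set p"

definition evars :: "'v qprefix \<Rightarrow> 'v set" where
  "evars p = {x. (QEx, x) \<in> set p}"

definition uvars :: "'v qprefix \<Rightarrow> 'v set" where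
  "uvars p = {x. (QAll, x) \<in> set p}"

definition Dep :: "'v qprefix \<Rightarrow> 'v \<Rightarrow> 'v set" where
  "Dep p y = {x. \<exists>u v w. p = u @ (QAll, x) # v @ (QEx, y) # w}"

type_synonym ('a, 'v) bprefix = "('a \<times> 'v) list"

definition is_bprefix :: "('a, 'r) signature \<Rightarrow> ('a, 'v) bprefix \<Rightarrow> bool" where
  "is_bprefix \<Sigma> b \<longleftrightarrow> distinct (map fst b) \<and> fst ` set b \<subseteq> Args \<Sigma>"

definition bargs :: "('a, 'v) bprefix \<Rightarrow> 'a set" where
  "bargs b = dom (map_of b)"

definition bvars :: "('a, 'v) bprefix \<Rightarrow> 'v set" where
  "bvars b = ran (map_of b)"

definition bind_all :: "('a, 'v) bprefix \<Rightarrow> ('a, 'r, 'v) fm \<Rightarrow> ('a, 'r, 'v) fm" where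
  "bind_all b \<phi> = foldr (\<lambda>(a, x). Bind a x) b \<phi>"

inductive is_derived_rel :: "('a, 'r) signature \<Rightarrow> 'a set \<Rightarrow> ('a, 'r, 'v) fm \<Rightarrow> bool"
  for \<Sigma> :: "('a, 'r) signature" and A :: "'a set" where
  "r \<in> Rels \<Sigma> \<Longrightarrow> ar \<Sigma> r = A \<Longrightarrow> is_derived_rel \<Sigma> A (Rel r)"
| "is_derived_rel \<Sigma> A \<phi> \<Longrightarrow> is_derived_rel \<Sigma> A (Neg \<phi>)"
| "is_derived_rel \<Sigma> A \<phi> \<Longrightarrow> is_derived_rel \<Sigma> A \<psi> \<Longrightarrow> is_derived_rel \<Sigma> A (Conj \<phi> \<psi>)"
| "is_derived_rel \<Sigma> A \<phi> \<Longrightarrow> is_derived_rel \<Sigma> A \<psi> \<Longrightarrow> is_derived_rel \<Sigma> A (Disj \<phi> \<psi>)"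

text \<open>A Skolem map is a HOL function of which only the values on \<open>Asg D (uvars p)\<close> matter;
  accordingly its range is taken over that set only.\<close>

type_synonym ('v, 'd) skolem = "('v \<rightharpoonup> 'd) \<Rightarrow> ('v \<rightharpoonup> 'd)"

definition is_skolem :: "'v qprefix \<Rightarrow> 'd set \<Rightarrow> ('v, 'd) skolem \<Rightarrow> bool" where
  "is_skolem p D \<theta> \<longleftrightarrow>
     (\<forall>\<rho>\<in>Asg D (uvars p). \<theta> \<rho> \<in> Asg D (qvars p)) \<and>
     (\<forall>\<rho>\<in>Asg D (uvars p). \<forall>x\<in>uvars p. \<theta> \<rho> x = \<rho> x) \<and>
     (\<forall>\<rho>\<in>Asg D (uvars p). \<forall>\<rho>'\<in>Asg D (uvars p). \<forall>y\<in>evars p.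
        \<rho> |` Dep p y = \<rho>' |` Dep p y \<longrightarrow> \<theta> \<rho> y = \<theta> \<rho>' y)"

definition skolem_rng :: "'v qprefix \<Rightarrow> 'd set \<Rightarrow> ('v, 'd) skolem \<Rightarrow> ('v \<rightharpoonup> 'd) set" where
  "skolem_rng p D \<theta> = \<theta> ` Asg D (uvars p)"

definition skolem_sat :: "('a, 'r) signature \<Rightarrow> ('a, 'r, 'd) struct \<Rightarrow> ('a, 'v, 'd) asg \<Rightarrow>
    'v qprefix \<Rightarrow> ('v, 'd) skolem \<Rightarrow> ('a, 'r, 'v) fm \<Rightarrow> bool" where
  "skolem_sat \<Sigma> R \<chi> p \<theta> \<psi> \<longleftrightarrow>
     (\<forall>\<chi>'. \<chi>' \<in> Asg (Dom R) (dom \<chi> \<union> Inr ` qvars p) \<and> \<chi> \<subseteq>\<^sub>m \<chi>' \<and>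
           (\<chi>' \<circ> Inr) |` qvars p \<in> skolem_rng p (Dom R) \<theta> \<longrightarrow> sat \<Sigma> R \<chi>' \<psi>)"

type_synonym ('a, 'v) schema = "'v qprefix \<times> ('a, 'v) bprefix"

abbreviation qpre :: "('a, 'v) schema \<Rightarrow> 'v qprefix" where "qpre \<equiv> fst"
abbreviation bpre :: "('a, 'v) schema \<Rightarrow> ('a, 'v) bprefix" where "bpre \<equiv> snd"

definition is_schema :: "('a, 'r) signature \<Rightarrow> ('a, 'v) schema \<Rightarrow> bool" where
  "is_schema \<Sigma> \<sigma> \<longleftrightarrow>
     is_qprefix (qpre \<sigma>) \<and> is_bprefix \<Sigma> (bpre \<sigma>) \<and> qvars (qpre \<sigma>) = bvars (bpre \<sigma>)"

definition sargs :: "('a, 'v) schema \<Rightarrow> 'a set" where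
  "sargs \<sigma> = bargs (bpre \<sigma>)"

definition Sch :: "('a, 'r) signature \<Rightarrow> 'a set \<Rightarrow> ('a, 'v) schema set" where
  "Sch \<Sigma> A = {\<sigma>. is_schema \<Sigma> \<sigma> \<and> sargs \<sigma> = A}"

type_synonym ('a, 'v, 'd) coupling = "('a, 'v) schema \<Rightarrow> ('v, 'd) skolem"

definition is_coupling_map ::
    "('a, 'v) schema set \<Rightarrow> 'd set \<Rightarrow> ('a, 'v, 'd) coupling \<Rightarrow> bool" where
  "is_coupling_map S D c \<longleftrightarrow> (\<forall>\<sigma>\<in>S. is_skolem (qpre \<sigma>) D (c \<sigma>))"

definition is_formula_function :: "('a, 'r) signature \<Rightarrow> ('a, 'v) schema set \<Rightarrow>
    (('a, 'v) schema \<Rightarrow> ('a, 'r, 'v) fm) \<Rightarrow> bool" where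
  "is_formula_function \<Sigma> S F \<longleftrightarrow> (\<forall>\<sigma>\<in>S. is_derived_rel \<Sigma> (sargs \<sigma>) (F \<sigma>))"

definition coupling_sat :: "('a, 'r) signature \<Rightarrow> ('a, 'r, 'd) struct \<Rightarrow> ('a, 'v) schema set \<Rightarrow>
    ('a, 'v, 'd) coupling \<Rightarrow> (('a, 'v) schema \<Rightarrow> ('a, 'r, 'v) fm) \<Rightarrow> bool" where
  "coupling_sat \<Sigma> R S c F \<longleftrightarrow>
     (\<forall>\<sigma>\<in>S. skolem_sat \<Sigma> R Map.empty (qpre \<sigma>) (c \<sigma>) (bind_all (bpre \<sigma>) (F \<sigma>)))"

definition Ent :: "'d set \<Rightarrow> ('a, 'v, 'd) coupling \<Rightarrow> ('a, 'v) schema set \<Rightarrow> 'a set \<Rightarrow>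
    ('a \<rightharpoonup> 'd) set" where
  "Ent D c S' A' = {t \<in> Asg D A'. \<forall>\<sigma>\<in>S'. \<exists>\<chi>\<in>skolem_rng (qpre \<sigma>) D (c \<sigma>).
     t = (\<chi> \<circ>\<^sub>m map_of (bpre \<sigma>)) |` A'}"

definition coupling_le :: "('a, 'r) signature \<Rightarrow> ('a, 'v) schema set \<Rightarrow>
    'd2 set \<Rightarrow> ('a, 'v, 'd2) coupling \<Rightarrow> 'd1 set \<Rightarrow> ('a, 'v, 'd1) coupling \<Rightarrow> bool" where
  "coupling_le \<Sigma> S D2 c2 D1 c1 \<longleftrightarrow>
     (\<forall>A' A S'. A' \<subseteq> A \<and> A \<subseteq> Args \<Sigma> \<and> S' \<subseteq> S \<inter> Sch \<Sigma> A \<longrightarrow>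
        Ent D2 c2 S' A' \<noteq> {} \<longrightarrow> Ent D1 c1 S' A' \<noteq> {})"

end

(* A tuple t over D2 on an argument set A is matched with the schemas on A whose Skolem map reaches
   it through the binding prefix. These schemas are entangled at t under c2, hence entangled under
   c1, which yields a twin tuple over D1 reached by all of them. Interpreting the relations
   on t as they are interpreted on its twin makes every derived relation agree on t and its twin. *)
theory Submission
  imports Defs
begin

lemma restrict_map_Asg:
  assumes "t \<in> Asg D A"
  shows "t |` A = t"
proof
  fix a
  show "(t |` A) a = t a"
    using assms by (cases "t a") (auto simp: Asg_def restrict_map_def)
qed

text \<open>Derived relations contain no quantifiers and no bindings, so the assignment never
  changes during evaluation and matters only through the tuple it gives on \<open>A\<close>.
  Agreement on atoms therefore passes through the connectives, even when the two structures have
  different domains.\<close>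

lemma sat_derived_rel_transfer:
  assumes "is_derived_rel \<Sigma> A \<phi>"
    and "\<And>r. r \<in> Rels \<Sigma> \<Longrightarrow> ar \<Sigma> r = A \<Longrightarrow>
      (\<chi>\<^sub>1 \<circ> Inl) |` A \<in> Interp R\<^sub>1 r \<longleftrightarrow> (\<chi>\<^sub>2 \<circ> Inl) |` A \<in> Interp R\<^sub>2 r"
  shows "sat \<Sigma> R\<^sub>1 \<chi>\<^sub>1 \<phi> \<longleftrightarrow> sat \<Sigma> R\<^sub>2 \<chi>\<^sub>2 \<phi>"
  using assms by (induction rule: is_derived_rel.induct) auto

text \<open>The simultaneous form of a sequence of bindings: every bound argument reads its variable
  in the original assignment.\<close>

definition bind_asg :: "('a, 'v) bprefix \<Rightarrow> ('a, 'v, 'd) asg \<Rightarrow> ('a, 'v, 'd) asg" where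
  "bind_asg b \<chi> = case_sum
     (\<lambda>a. case map_of b a of None \<Rightarrow> \<chi> (Inl a) | Some x \<Rightarrow> \<chi> (Inr x)) (\<chi> \<circ> Inr)"

text \<open>Bindings write arguments and read variables, so none affects the value another one
  reads. Only repeated arguments could cause trouble: the innermost binding wins in the formula, the
  first entry wins in \<open>map_of\<close>. Distinctness rules this out.\<close>

lemma sat_bind_all:
  assumes "distinct (map fst b)"
  shows "sat \<Sigma> R \<chi> (bind_all b \<phi>) \<longleftrightarrow> sat \<Sigma> R (bind_asg b \<chi>) \<phi>"
  using assms
proof (induction b arbitrary: \<chi>)
  case Nil
  have "bind_asg [] \<chi> = \<chi>"
    by (auto simp: bind_asg_def fun_eq_iff split: sum.split)
  then show ?case
    by (simp add: bind_all_def)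
next
  case (Cons ax b)
  obtain a x where ax: "ax = (a, x)"
    by fastforce
  with Cons.prems have "map_of b a = None"
    by (simp add: map_of_eq_None_iff)
  then have "bind_asg b (\<chi>(Inl a := \<chi> (Inr x))) = bind_asg (ax # b) \<chi>"
    by (auto simp: ax bind_asg_def fun_eq_iff split: sum.split option.split)
  with Cons show ?case
    by (simp add: ax bind_all_def)
qed

lemma bind_asg_case_sum_empty:
  "bind_asg b (case_sum Map.empty \<rho>) = case_sum (\<rho> \<circ>\<^sub>m map_of b) \<rho>"
  by (auto simp: bind_asg_def map_comp_def fun_eq_iff split: sum.split option.split)

text \<open>An extension of the empty assignment to the prefix variables is determined by its
  variable part. Conversely, the Skolem property gives each member of the range the domain and
  values that such an extension needs.\<close>

lemma skolem_sat_empty_iff: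
  fixes R :: "('a, 'r, 'd) struct" and p :: "'v qprefix"
  assumes "is_skolem p (Dom R) \<theta>"
  shows "skolem_sat \<Sigma> R Map.empty p \<theta> \<psi> \<longleftrightarrow>
    (\<forall>\<rho>\<in>skolem_rng p (Dom R) \<theta>. sat \<Sigma> R (case_sum Map.empty \<rho>) \<psi>)"
proof
  assume sat: "skolem_sat \<Sigma> R Map.empty p \<theta> \<psi>"
  show "\<forall>\<rho>\<in>skolem_rng p (Dom R) \<theta>. sat \<Sigma> R (case_sum Map.empty \<rho>) \<psi>"
  proof
    fix \<rho> assume \<rho>: "\<rho> \<in> skolem_rng p (Dom R) \<theta>"
    let ?\<chi> = "case_sum Map.empty \<rho> :: 'a + 'v \<rightharpoonup> 'd"
    from \<rho> assms have \<rho>_Asg: "\<rho> \<in> Asg (Dom R) (qvars p)"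
      by (auto simp: skolem_rng_def is_skolem_def)
    then have \<rho>_dom: "dom \<rho> = qvars p" and \<rho>_ran: "ran \<rho> \<subseteq> Dom R"
      by (auto simp: Asg_def)
    have "dom ?\<chi> = Inr ` dom \<rho>"
    proof (intro set_eqI)
      fix z
      show "z \<in> dom ?\<chi> \<longleftrightarrow> z \<in> Inr ` dom \<rho>"
        by (cases z) auto
    qed
    moreover have "ran ?\<chi> \<subseteq> Dom R"
    proof
      fix d assume "d \<in> ran ?\<chi>"
      then obtain z where "?\<chi> z = Some d"
        by (auto simp: ran_def)
      then have "d \<in> ran \<rho>"
        by (cases z) (auto intro: ranI)
      with \<rho>_ran show "d \<in> Dom R" ..
    qed
    moreover have "(?\<chi> \<circ> Inr) |` qvars p = \<rho>"
      using restrict_map_Asg[OF \<rho>_Asg] by (simp add: comp_def)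
    ultimately show "sat \<Sigma> R ?\<chi> \<psi>"
      using sat \<rho> \<rho>_dom by (simp add: skolem_sat_def Asg_def)
  qed
next
  assume sat: "\<forall>\<rho>\<in>skolem_rng p (Dom R) \<theta>. sat \<Sigma> R (case_sum Map.empty \<rho>) \<psi>"
  show "skolem_sat \<Sigma> R Map.empty p \<theta> \<psi>"
    unfolding skolem_sat_def
  proof (intro allI impI, elim conjE)
    fix \<chi> :: "'a + 'v \<rightharpoonup> 'd"
    assume \<chi>: "\<chi> \<in> Asg (Dom R) (dom Map.empty \<union> Inr ` qvars p)"
      and rng: "(\<chi> \<circ> Inr) |` qvars p \<in> skolem_rng p (Dom R) \<theta>"
    from \<chi> have dom: "dom \<chi> = Inr ` qvars p"
      by (simp add: Asg_def)
    \<comment> \<open>The domain of \<open>\<chi>\<close> consists of prefix variables only, so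
      \<open>\<chi>\<close> is undefined at every argument.\<close>
    have "\<chi> z = case_sum Map.empty ((\<chi> \<circ> Inr) |` qvars p) z" for z
    proof (cases "z \<in> dom \<chi>")
      case True
      with dom show ?thesis by auto
    next
      case False
      with dom show ?thesis
        by (cases z) (auto simp: restrict_map_def)
    qed
    then have "\<chi> = case_sum Map.empty ((\<chi> \<circ> Inr) |` qvars p)"
      by blast
    with sat rng show "sat \<Sigma> R \<chi> \<psi>"
      by metis
  qed
qed

text \<open>Eliminates prefixes from the satisfaction relation: what remains is the truth of
  \<open>F \<sigma>\<close> at the tuples which the Skolem map produces through the binding
  prefix.\<close>

lemma coupling_sat_iff:
  assumes "\<forall>\<sigma>\<in>S. is_schema \<Sigma> \<sigma>" and "is_coupling_map S (Dom R) c"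
  shows "coupling_sat \<Sigma> R S c F \<longleftrightarrow>
    (\<forall>\<sigma>\<in>S. \<forall>\<rho>\<in>skolem_rng (qpre \<sigma>) (Dom R) (c \<sigma>).
      sat \<Sigma> R (case_sum (\<rho> \<circ>\<^sub>m map_of (bpre \<sigma>)) \<rho>) (F \<sigma>))"
  using assms
  by (simp add: coupling_sat_def is_coupling_map_def is_schema_def is_bprefix_def
      skolem_sat_empty_iff sat_bind_all bind_asg_case_sum_empty)

text \<open>The composition is total on the bound arguments because a schema binds exactly the
  variables that it quantifies, and \<open>\<rho>\<close> is defined on all of those.\<close>

lemma map_comp_binding_in_Asg:
  assumes "is_schema \<Sigma> \<sigma>" and "is_skolem (qpre \<sigma>) D \<theta>" and "\<rho> \<in> skolem_rng (qpre \<sigma>) D \<theta>"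
  shows "\<rho> \<circ>\<^sub>m map_of (bpre \<sigma>) \<in> Asg D (sargs \<sigma>)"
proof -
  from assms have "\<rho> \<in> Asg D (bvars (bpre \<sigma>))"
    by (auto simp: skolem_rng_def is_skolem_def is_schema_def)
  then have dom: "dom \<rho> = ran (map_of (bpre \<sigma>))" and ran: "ran \<rho> \<subseteq> D"
    by (auto simp: Asg_def bvars_def)
  have "dom (\<rho> \<circ>\<^sub>m map_of (bpre \<sigma>)) = dom (map_of (bpre \<sigma>))"
  proof (intro equalityI subsetI)
    fix a assume "a \<in> dom (map_of (bpre \<sigma>))"
    then obtain x where x: "map_of (bpre \<sigma>) a = Some x"
      by blast
    then have "x \<in> dom \<rho>"
      by (auto simp: dom intro: ranI)
    with x show "a \<in> dom (\<rho> \<circ>\<^sub>m map_of (bpre \<sigma>))"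
      by (auto simp: map_comp_def)
  qed (auto simp: map_comp_def split: option.splits)
  moreover have "ran (\<rho> \<circ>\<^sub>m map_of (bpre \<sigma>)) \<subseteq> ran \<rho>"
    by (auto simp: ran_def map_comp_def split: option.splits)
  ultimately show ?thesis
    using ran by (auto simp: Asg_def sargs_def bargs_def)
qed

lemma sargs_subset_Args: "is_schema \<Sigma> \<sigma> \<Longrightarrow> sargs \<sigma> \<subseteq> Args \<Sigma>"
  by (auto simp: is_schema_def is_bprefix_def sargs_def bargs_def dom_map_of_conv_image_fst)

theorem mainTheorem9:
  fixes \<Sigma> :: "('a, 'r) signature"
    and S :: "('a, 'v) schema set"
    and D1 :: "'d1 set" and D2 :: "'d2 set"
    and c1 :: "('a, 'v, 'd1) coupling" and c2 :: "('a, 'v, 'd2) coupling"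
    and F :: "('a, 'v) schema \<Rightarrow> ('a, 'r, 'v) fm"
  assumes "is_signature \<Sigma>"
    and "finite S" and "\<forall>\<sigma>\<in>S. is_schema \<Sigma> \<sigma>"
    and "D2 \<noteq> {}"
    and "is_coupling_map S D1 c1" and "is_coupling_map S D2 c2"
    and "coupling_le \<Sigma> S D2 c2 D1 c1"
    and "is_formula_function \<Sigma> S F"
    and "\<exists>R1 :: ('a, 'r, 'd1) struct.
           is_structure \<Sigma> R1 \<and> Dom R1 = D1 \<and> coupling_sat \<Sigma> R1 S c1 F"
  shows "\<exists>R2 :: ('a, 'r, 'd2) struct.
           is_structure \<Sigma> R2 \<and> Dom R2 = D2 \<and> coupling_sat \<Sigma> R2 S c2 F"
proof -
  note schemas = assms(3) and c1 = assms(5) and c2 = assms(6) and le = assms(7)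
  from assms(9) obtain R1 :: "('a, 'r, 'd1) struct"
    where D1: "Dom R1 = D1" and sat1: "coupling_sat \<Sigma> R1 S c1 F"
    by blast
  define reaching where "reaching t = {\<sigma> \<in> S \<inter> Sch \<Sigma> (dom t).
    \<exists>\<rho>\<in>skolem_rng (qpre \<sigma>) D2 (c2 \<sigma>). t = \<rho> \<circ>\<^sub>m map_of (bpre \<sigma>)}" for t
  \<comment> \<open>The choice depends on \<open>t\<close> alone, so all schemas reaching
    \<open>t\<close> and all relations share the same twin.\<close>
  define twin where "twin t = (SOME t'. t' \<in> Ent D1 c1 (reaching t) (dom t))" for t
  define R2 :: "('a, 'r, 'd2) struct" where
    "R2 = \<lparr>Dom = D2, Interp = (\<lambda>r. {t \<in> Asg D2 (ar \<Sigma> r). twin t \<in> Interp R1 r})\<rparr>"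
  have D2: "Dom R2 = D2"
    by (simp add: R2_def)
  have "is_structure \<Sigma> R2"
    using \<open>D2 \<noteq> {}\<close> by (auto simp: is_structure_def R2_def)
  moreover have "coupling_sat \<Sigma> R2 S c2 F"
    unfolding coupling_sat_iff[OF schemas c2[folded D2]] D2
  proof (intro ballI)
    fix \<sigma> \<rho>\<^sub>2
    assume \<sigma>: "\<sigma> \<in> S" and \<rho>\<^sub>2: "\<rho>\<^sub>2 \<in> skolem_rng (qpre \<sigma>) D2 (c2 \<sigma>)"
    define t where "t = \<rho>\<^sub>2 \<circ>\<^sub>m map_of (bpre \<sigma>)"
    from \<sigma> schemas have schema: "is_schema \<Sigma> \<sigma>"
      by blast
    have t: "t \<in> Asg D2 (sargs \<sigma>)"
      using map_comp_binding_in_Asg[OF schema _ \<rho>\<^sub>2] c2 \<sigma>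
      by (simp add: t_def is_coupling_map_def)
    then have dom_t: "dom t = sargs \<sigma>"
      by (simp add: Asg_def)
    have \<sigma>_reaching: "\<sigma> \<in> reaching t"
      using \<sigma> schema \<rho>\<^sub>2 by (auto simp: reaching_def Sch_def t_def dom_t[unfolded t_def])
    \<comment> \<open>The order on couplings is applied with both argument sets equal to
      \<open>dom t\<close>; \<open>t\<close> itself witnesses the entanglement under
      \<open>c2\<close>.\<close>
    have "t \<in> Ent D2 c2 (reaching t) (dom t)"
      using t restrict_map_Asg[OF t] by (force simp: Ent_def reaching_def dom_t)
    moreover have "reaching t \<subseteq> S \<inter> Sch \<Sigma> (dom t)"
      by (auto simp: reaching_def)
    moreover have "dom t \<subseteq> Args \<Sigma>"
      using sargs_subset_Args[OF schema] by (simp add: dom_t)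
    ultimately have "Ent D1 c1 (reaching t) (dom t) \<noteq> {}"
      using le unfolding coupling_le_def by blast
    then have twin: "twin t \<in> Ent D1 c1 (reaching t) (sargs \<sigma>)"
      unfolding twin_def dom_t by (simp add: some_in_eq)
    \<comment> \<open>Since \<open>\<sigma>\<close> is among the schemas reaching \<open>t\<close>,
      the twin is also produced by \<open>\<sigma>\<close> under \<open>c1\<close>, and so
      \<open>F \<sigma>\<close> holds there in \<open>R1\<close>.\<close>
    with \<sigma>_reaching obtain \<rho>\<^sub>1 where \<rho>\<^sub>1: "\<rho>\<^sub>1 \<in> skolem_rng (qpre \<sigma>) D1 (c1 \<sigma>)"
      and twin_eq: "twin t = (\<rho>\<^sub>1 \<circ>\<^sub>m map_of (bpre \<sigma>)) |` sargs \<sigma>"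
      by (auto simp: Ent_def)
    have "sat \<Sigma> R1 (case_sum (\<rho>\<^sub>1 \<circ>\<^sub>m map_of (bpre \<sigma>)) \<rho>\<^sub>1) (F \<sigma>)"
      using sat1 coupling_sat_iff[OF schemas, of R1 c1 F] c1 D1 \<sigma> \<rho>\<^sub>1 by simp
    moreover have "sat \<Sigma> R1 (case_sum (\<rho>\<^sub>1 \<circ>\<^sub>m map_of (bpre \<sigma>)) \<rho>\<^sub>1) (F \<sigma>) \<longleftrightarrow>
      sat \<Sigma> R2 (case_sum t \<rho>\<^sub>2) (F \<sigma>)"
    proof (rule sat_derived_rel_transfer)
      show "is_derived_rel \<Sigma> (sargs \<sigma>) (F \<sigma>)"
        using assms(8) \<sigma> by (simp add: is_formula_function_def)
    \<comment> \<open>For atoms over \<open>sargs \<sigma>\<close> the restricted argument parts are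
      \<open>twin t\<close> and \<open>t\<close>, whose memberships agree by the interpretation
      chosen in \<open>R2\<close>.\<close>
    qed (use t restrict_map_Asg[OF t] twin_eq in \<open>simp add: R2_def comp_def\<close>)
    ultimately show "sat \<Sigma> R2 (case_sum (\<rho>\<^sub>2 \<circ>\<^sub>m map_of (bpre \<sigma>)) \<rho>\<^sub>2) (F \<sigma>)"
      by (simp add: t_def)
  qed
  ultimately show ?thesis
    using D2 by blast
qed

end
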